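(* Let $\rho:\mathbb{R}\to(0,\infty)$ be $2\pi$-periodic, let $\bar\Omega$ be the associated starlike domain in polar coordinates, and let $S(\xi,\phi)=\left(\frac{2\xi}{\rho(\phi)},\phi\right)$. Then the Lebesgue constant $\bar\Lambda_{n_1n_2}$ of the interpolant $\mathcal{I}^S$ on $\bar\Omega$ at the nodes $G_{i,j}=\left(\tfrac{r_i\rho(\theta_j)}{2},\theta_j\right)$, $0\le i\le n_1$, $0\le j\le n_2-1$, satisfies, as $n_1,n_2\to\infty$, $$\bar\Lambda_{n_1n_2}=\mathcal{O}(\log n_1\,\log n_2).$$
   Context: The starlike domain (with center at the origin) is written in polar coordinates as $\bar\Omega=\{(\xi,\phi):0\le\xi\le\rho(\phi),\ \phi\in[0,2\pi)\}$, and $S$ maps $\bar\Omega$ onto $E=[0,2]\times[0,2\pi)$ (polar coordinates of the closed disk of radius 2). Let $r_i=1-\cos(i\pi/n_1)$, $i=0,\dots,n_1$, and $\theta_j=2\pi j/n_2$, $j=0,\dots,n_2-1$; $\delta_0=\delta_{n_1}=1/2$ and $\delta_i=1$ otherwise; $\operatorname{cst}=\csc$ if $n_2$ is odd, $\operatorname{cst}=\cot$ if $n_2$ is even. Define $$b_i^{(1)}(r)=\frac{\frac{(-1)^i\delta_i}{r-r_i}}{\sum_{k=0}^{n_1}\frac{(-1)^k\delta_k}{r-r_k}},\qquad b_j^{(2)}(\theta)=\frac{(-1)^j\operatorname{cst}\left(\frac{\theta-\theta_j}{2}\right)}{\sum_{k=0}^{n_2-1}(-1)^k\operatorname{cst}\left(\frac{\theta-\theta_k}{2}\right)},$$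 extended by continuity at the nodes. For $f:\bar\Omega\to\mathbb{R}$ the interpolant is $$\mathcal{I}^S[f](\xi,\phi)=\sum_{i=0}^{n_1}\sum_{j=0}^{n_2-1}f(G_{i,j})\,b_i^{(1)}\left(\tfrac{2\xi}{\rho(\phi)}\right)b_j^{(2)}(\phi),$$ and its Lebesgue constant is $$\bar\Lambda_{n_1n_2}=\sup_{(\xi,\phi)\in\bar\Omega}\sum_{i=0}^{n_1}\sum_{j=0}^{n_2-1}\left|b_i^{(1)}\left(\tfrac{2\xi}{\rho(\phi)}\right)\right|\left|b_j^{(2)}(\phi)\right|.$$ *)

theory Defs
  imports "HOL-Analysis.Analysis" "HOL-Library.Landau_Symbols"
begin

(* Points of the starlike domain are pairs (xi, phi) of polar coordinates. *)

definition starlike_domain :: "(real \<Rightarrow> real) \<Rightarrow> (real \<times> real) set" where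
  "starlike_domain \<rho> = {(\<xi>, \<phi>). 0 \<le> \<xi> \<and> \<xi> \<le> \<rho> \<phi> \<and> 0 \<le> \<phi> \<and> \<phi> < 2 * pi}"

definition star_map :: "(real \<Rightarrow> real) \<Rightarrow> real \<times> real \<Rightarrow> real \<times> real" where
  "star_map \<rho> = (\<lambda>(\<xi>, \<phi>). (2 * \<xi> / \<rho> \<phi>, \<phi>))"

definition radial_node :: "nat \<Rightarrow> nat \<Rightarrow> real" where
  "radial_node n i = 1 - cos (real i * pi / real n)"

definition angular_node :: "nat \<Rightarrow> nat \<Rightarrow> real" where
  "angular_node n j = 2 * pi * real j / real n"

definition star_node :: "(real \<Rightarrow> real) \<Rightarrow> nat \<Rightarrow> nat \<Rightarrow> nat \<Rightarrow> nat \<Rightarrow> real \<times> real" where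
  "star_node \<rho> n1 n2 i j =
     (radial_node n1 i * \<rho> (angular_node n2 j) / 2, angular_node n2 j)"

definition end_weight :: "nat \<Rightarrow> nat \<Rightarrow> real" where
  "end_weight n i = (if i = 0 \<or> i = n then 1 / 2 else 1)"

(* Cosecant for odd n, cotangent for even n. *)
definition cst :: "nat \<Rightarrow> real \<Rightarrow> real" where
  "cst n x = (if odd n then 1 / sin x else cot x)"

(* The quotients below are meaningless at the nodes, where division by zero would
   return 0.  There the basis functions take the limit of the quotient, that is, its
   continuous extension.  In the angular case the nodes recur with period 2 pi. *)

definition radial_quotient :: "nat \<Rightarrow> nat \<Rightarrow> real \<Rightarrow> real" where
  "radial_quotient n i r =
     ((-1) ^ i * end_weight n i / (r - radial_node n i)) /
     (\<Sum>k = 0..n. (-1) ^ k * end_weight n k / (r - radial_node n k))"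

definition radial_basis :: "nat \<Rightarrow> nat \<Rightarrow> real \<Rightarrow> real" where
  "radial_basis n i r =
     (if \<exists>k\<le>n. r = radial_node n k then Lim (at r) (radial_quotient n i)
      else radial_quotient n i r)"

definition angular_quotient :: "nat \<Rightarrow> nat \<Rightarrow> real \<Rightarrow> real" where
  "angular_quotient n j \<theta> =
     ((-1) ^ j * cst n ((\<theta> - angular_node n j) / 2)) /
     (\<Sum>k<n. (-1) ^ k * cst n ((\<theta> - angular_node n k) / 2))"

definition angular_basis :: "nat \<Rightarrow> nat \<Rightarrow> real \<Rightarrow> real" where
  "angular_basis n j \<theta> =
     (if \<exists>k<n. \<exists>m::int. \<theta> = angular_node n k + 2 * pi * of_int m
      then Lim (at \<theta>) (angular_quotient n j)
      else angular_quotient n j \<theta>)"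

definition star_interpolant ::
  "(real \<Rightarrow> real) \<Rightarrow> nat \<Rightarrow> nat \<Rightarrow> (real \<times> real \<Rightarrow> real) \<Rightarrow> real \<times> real \<Rightarrow> real" where
  "star_interpolant \<rho> n1 n2 f p =
     (\<Sum>i = 0..n1. \<Sum>j<n2. f (star_node \<rho> n1 n2 i j) *
        radial_basis n1 i (fst (star_map \<rho> p)) * angular_basis n2 j (snd (star_map \<rho> p)))"

definition lebesgue_function ::
  "(real \<Rightarrow> real) \<Rightarrow> nat \<Rightarrow> nat \<Rightarrow> real \<times> real \<Rightarrow> real" where
  "lebesgue_function \<rho> n1 n2 p =
     (\<Sum>i = 0..n1. \<Sum>j<n2.
        \<bar>radial_basis n1 i (fst (star_map \<rho> p))\<bar> * \<bar>angular_basis n2 j (snd (star_map \<rho> p))\<bar>)"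

(* A real supremum: it has its intended value only if the Lebesgue function is
   bounded above on the domain. *)
definition lebesgue_constant :: "(real \<Rightarrow> real) \<Rightarrow> nat \<Rightarrow> nat \<Rightarrow> real" where
  "lebesgue_constant \<rho> n1 n2 = (SUP p\<in>starlike_domain \<rho>. lebesgue_function \<rho> n1 n2 p)"

lemma abs_star_interpolant_le:
  assumes "\<And>i j. i \<le> n1 \<Longrightarrow> j < n2 \<Longrightarrow> \<bar>f (star_node \<rho> n1 n2 i j)\<bar> \<le> M"
  shows "\<bar>star_interpolant \<rho> n1 n2 f p\<bar> \<le> M * lebesgue_function \<rho> n1 n2 p"
proof -
  have "\<bar>star_interpolant \<rho> n1 n2 f p\<bar> \<le>
      (\<Sum>i = 0..n1. \<Sum>j<n2. \<bar>f (star_node \<rho> n1 n2 i j) *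
        radial_basis n1 i (fst (star_map \<rho> p)) * angular_basis n2 j (snd (star_map \<rho> p))\<bar>)"
    unfolding star_interpolant_def
    by (rule order_trans[OF sum_abs], rule sum_mono, rule sum_abs)
  also have "\<dots> \<le> (\<Sum>i = 0..n1. \<Sum>j<n2. M *
      (\<bar>radial_basis n1 i (fst (star_map \<rho> p))\<bar> * \<bar>angular_basis n2 j (snd (star_map \<rho> p))\<bar>))"
    using assms by (intro sum_mono) (simp add: abs_mult mult.assoc mult_right_mono)
  also have "\<dots> = M * lebesgue_function \<rho> n1 n2 p"
    by (simp add: lebesgue_function_def sum_distrib_left)
  finally show ?thesis .
qed

lemma radial_node_inj:
  assumes "i \<le> n" "k \<le> n" "n > 0" "radial_node n i = radial_node n k"
  shows "i = k"
proof -
  have "real i * pi / real n = real k * pi / real n"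
    by (rule cos_inj_pi) (use assms in \<open>auto simp: radial_node_def field_simps\<close>)
  thus ?thesis using assms by simp
qed

lemma sin_angular_node_diff:
  assumes "i < n" "k < n" "i \<noteq> k"
  shows "sin ((angular_node n i - angular_node n k)/2) \<noteq> 0"
proof
  assume "sin ((angular_node n i - angular_node n k)/2) = 0"
  then obtain m::int where m: "(angular_node n i - angular_node n k)/2 = of_int m * pi"
    by (auto simp: sin_zero_iff_int2)
  have "(real i - real k) * pi = of_int m * real n * pi"
    using m assms by (simp add: angular_node_def field_simps)
  hence "real_of_int (int i - int k) = real_of_int (m * int n)" by simp
  hence e: "int i - int k = m * int n" by (simp only: of_int_eq_iff)
  have "\<bar>int i - int k\<bar> < int n" using assms by auto
  hence "\<bar>m\<bar> * int n < 1 * int n" unfolding e by (simp add: abs_mult)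
  hence "\<bar>m\<bar> < 1" using assms(1) by (metis mult_less_cancel_right_pos of_nat_0_less_iff gr_zeroI not_less_zero)
  with e assms(3) show False by simp
qed

lemma radial_basis_node:
  assumes "n > 0" "i \<le> n" "m \<le> n"
  shows "radial_basis n i (radial_node n m) = (if i = m then 1 else 0)"
proof -
  define R where "R = radial_node n m"
  define w where "w k = (-1::real)^k * end_weight n k" for k
  have wm: "w m \<noteq> 0" by (auto simp: w_def end_weight_def)
  let ?g = "\<lambda>k r. if k = m then w m else (r - R) * (w k / (r - radial_node n k))"
  have lim1: "(?g k \<longlongrightarrow> (if k = m then w m else 0)) (at R)" if "k \<le> n" for k
  proof (cases "k = m")
    case False
    hence "R \<noteq> radial_node n k" using radial_node_inj assms that unfolding R_def by metis
    thus ?thesis using False by (auto intro!: tendsto_eq_intros)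
  qed auto
  have "((\<lambda>r. ?g i r / (\<Sum>k=0..n. ?g k r)) \<longlongrightarrow> (if i = m then w m else 0) / (\<Sum>k=0..n. (if k = m then w m else 0))) (at R)"
    using assms wm by (intro tendsto_divide tendsto_sum lim1) (auto simp: sum.delta)
  also have "(if i = m then w m else 0) / (\<Sum>k=0..n. (if k = m then w m else 0)) = (if i = m then 1 else (0::real))"
    using assms wm by (auto simp: sum.delta)
  finally have "(radial_quotient n i \<longlongrightarrow> (if i = m then 1 else 0)) (at R)"
  proof (rule Lim_transform_eventually)
    show "\<forall>\<^sub>F r in at R. ?g i r / (\<Sum>k=0..n. ?g k r) = radial_quotient n i r"
      unfolding eventually_at_filter
    proof (intro always_eventually allI impI)
      fix r assume "r \<noteq> R"
      have g: "?g k r = (r - R) * (w k / (r - radial_node n k))" for k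
        using \<open>r \<noteq> R\<close> by (auto simp: R_def)
      show "?g i r / (\<Sum>k=0..n. ?g k r) = radial_quotient n i r"
        unfolding g sum_distrib_left[symmetric] using \<open>r \<noteq> R\<close>
        by (simp add: radial_quotient_def w_def)
    qed
  qed
  hence "Lim (at R) (radial_quotient n i) = (if i = m then 1 else 0)"
    by (intro tendsto_Lim) auto
  thus ?thesis using assms unfolding radial_basis_def R_def by auto
qed

lemma angular_basis_node:
  assumes "j < n" "m < n"
  shows "angular_basis n j (angular_node n m) = (if j = m then 1 else 0)"
proof -
  define R where "R = angular_node n m"
  define s where "s x = sin ((x - R)/2)" for x
  define c where "c x = (if odd n then 1 else cos ((x-R)/2))" for x
  let ?g = "\<lambda>k r. (-1::real)^k * (if k = m then c r else s r * cst n ((r - angular_node n k)/2))"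
  have lim1: "(?g k \<longlongrightarrow> (if k = m then (-1)^m else 0)) (at R)" if "k < n" for k
  proof (cases "k = m")
    case True
    thus ?thesis by (cases "odd n") (auto simp: c_def intro!: tendsto_eq_intros)
  next
    case False
    hence "sin ((R - angular_node n k)/2) \<noteq> 0" using sin_angular_node_diff[of m n k] assms that unfolding R_def by auto
    thus ?thesis using False by (cases "odd n") (auto simp: cst_def s_def cot_def intro!: tendsto_eq_intros)
  qed
  have "((\<lambda>r. ?g j r / (\<Sum>k<n. ?g k r)) \<longlongrightarrow> (if j = m then (-1)^m else 0) / (\<Sum>k<n. (if k = m then (-1)^m else 0))) (at R)"
    using assms by (intro tendsto_divide tendsto_sum lim1) (auto simp: sum.delta)
  also have "(if j = m then (-1)^m else 0) / (\<Sum>k<n. (if k = m then (-1)^m else 0)) = (if j = m then 1 else (0::real))"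
    using assms by (auto simp: sum.delta)
  finally have "(angular_quotient n j \<longlongrightarrow> (if j = m then 1 else 0)) (at R)"
  proof (rule Lim_transform_eventually)
    have sR: "\<forall>\<^sub>F r in at R. s r \<noteq> 0"
    proof -
      have "\<forall>\<^sub>F r in at R. r \<in> {R - 1<..<R + 1} - {R}"
        by (rule eventually_at_in_open) auto
      then show ?thesis
      proof eventually_elim
        case (elim r)
        have "sin \<bar>(r - R)/2\<bar> > 0"
          by (rule sin_gt_zero) (use elim pi_gt3 in auto)
        thus ?case by (auto simp: s_def abs_if split: if_splits)
      qed
    qed
    thus "\<forall>\<^sub>F r in at R. ?g j r / (\<Sum>k<n. ?g k r) = angular_quotient n j r"
    proof eventually_elim
      case (elim r)
      have g: "?g k r = s r * ((-1)^k * cst n ((r - angular_node n k)/2))" for k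
        using elim by (auto simp: R_def c_def s_def cst_def cot_def)
      show ?case
        unfolding g sum_distrib_left[symmetric] using elim
        by (simp add: angular_quotient_def)
    qed
  qed
  hence L: "Lim (at R) (angular_quotient n j) = (if j = m then 1 else 0)"
    by (intro tendsto_Lim) auto
  have "\<exists>k<n. \<exists>l::int. R = angular_node n k + 2 * pi * of_int l"
    using assms by (intro exI[of _ m] conjI exI[of _ 0]) (auto simp: R_def)
  thus ?thesis using L unfolding angular_basis_def R_def by auto
qed

lemma star_interpolant_node:
  assumes "\<And>\<phi>. 0 < \<rho> \<phi>" "n1 > 0" "i \<le> n1" "j < n2"
  shows "star_interpolant \<rho> n1 n2 f (star_node \<rho> n1 n2 i j) = f (star_node \<rho> n1 n2 i j)"
proof -
  have s: "star_map \<rho> (star_node \<rho> n1 n2 i j) = (radial_node n1 i, angular_node n2 j)"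
    using less_imp_neq[OF assms(1)[of "angular_node n2 j"]] by (simp add: star_map_def star_node_def)
  have "star_interpolant \<rho> n1 n2 f (star_node \<rho> n1 n2 i j) =
    (\<Sum>i' = 0..n1. \<Sum>j'<n2. if j' = j then (if i' = i then f (star_node \<rho> n1 n2 i j) else 0) else 0)"
    unfolding star_interpolant_def s
    by (intro sum.cong refl) (use assms in \<open>auto simp: radial_basis_node angular_basis_node\<close>)
  also have "\<dots> = f (star_node \<rho> n1 n2 i j)" using assms by (simp add: sum.delta)
  finally show ?thesis .
qed

end

theory Submission
  imports Defs
begin

text \<open>
  The Lebesgue function is a product of a radial and an angular factor.  In the angular
  factor the Dirichlet kernel gives the denominator exactly: it is
  \<open>n / sin (n \<theta> / 2)\<close> for either parity of \<open>n\<close>, so each basis function is a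
  quotient \<open>sin (n y) cst y / n\<close> that is at most 1 and decays like the reciprocal of
  the circular distance to its node; summing over the nodes gives two harmonic sums.
  The radial factor reduces to the angular one.  With \<open>r = 1 - cos t\<close>, the identity
  \<open>cot ((t - s) / 2) + cot ((t + s) / 2) = 2 sin t / (cos s - cos t)\<close> writes each
  radial basis function with \<open>n + 1\<close> nodes as the sum of the two angular basis functions
  with \<open>2 n\<close> nodes attached to \<open>s\<close> and \<open>2 \<pi> - s\<close>; at the two end nodes these
  coincide, which accounts for the weight \<open>1 / 2\<close>.
\<close>

section \<open>Cosine sums and the closed form of the angular denominator\<close>

lemma sum_cos_equally_spaced:
  fixes a :: real
  assumes "0 < l" "l < n"
  shows "(\<Sum>k<n. cos (a - 2 * pi * real l * real k / real n)) = 0"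
proof -
  \<comment> \<open>Half the step between consecutive angles. Multiplying by
    \<open>2 * sin b\<close> makes the sum telescope; the end terms agree because their arguments
    differ by \<open>2 * pi * l\<close>, and \<open>0 < b < pi\<close> lets \<open>sin b\<close> be
    cancelled.\<close>
  define b where "b = pi * real l / real n"
  have b: "0 < b" "b < pi" "real n * b = pi * real l"
    using assms by (auto simp: b_def field_simps)
  define f where "f k = sin (a + b - 2 * real k * b)" for k :: nat
  have tel: "2 * sin b * cos (a - 2 * real k * b) = f k - f (Suc k)" for k
  proof -
    have e: "f (Suc k) = sin ((a - 2 * real k * b) - b)" "f k = sin ((a - 2 * real k * b) + b)"
      by (simp_all add: f_def algebra_simps)
    show ?thesis unfolding e by (simp only: sin_add sin_diff) simp
  qed
  have "2 * sin b * (\<Sum>k<n. cos (a - 2 * real k * b)) = f 0 - f n"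
    by (simp add: sum_distrib_left tel sum_lessThan_telescope')
  also have "f n = sin (a + b - 2 * real l * pi)"
    using b(3) by (simp add: f_def mult.assoc) (simp add: mult_ac)
  also have "\<dots> = sin (a + b)"
    by (simp only: sin_diff sin_2npi cos_2npi mult_1_right mult_zero_right diff_zero)
  finally have "(\<Sum>k<n. cos (a - 2 * real k * b)) = 0"
    using sin_gt_zero[of b] b by (simp add: f_def)
  then show ?thesis by (simp add: b_def mult.commute mult.left_commute)
qed

lemma dirichlet_kernel:
  "sin ((2 * real p + 1) * y) = sin y * (1 + 2 * (\<Sum>l=1..p. cos (2 * real l * y)))"
proof (induction p)
  case (Suc p)
  have "sin ((2 * real (Suc p) + 1) * y) = sin (2 * real (Suc p) * y + y)"
    "sin ((2 * real p + 1) * y) = sin (2 * real (Suc p) * y - y)"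
    by (simp_all add: algebra_simps)
  hence "sin ((2 * real (Suc p) + 1) * y) - sin ((2 * real p + 1) * y) = 2 * sin y * cos (2 * real (Suc p) * y)"
    by (simp only: sin_add sin_diff) simp
  with Suc show ?case by (simp add: algebra_simps del: of_nat_Suc)
qed simp

text \<open>One formula for both parities. Odd \<open>n\<close> is the Dirichlet kernel itself; for
  even \<open>n\<close> the cotangent gives \<open>sin ((n + 1) * y) / sin y - cos (n * y)\<close>,
  so for \<open>n > 0\<close> the top frequency has coefficient 1 instead of 2.\<close>

lemma sin_mult_cst:
  assumes "sin y \<noteq> 0"
  shows "sin (real n * y) * cst n y =
    1 + 2 * (\<Sum>l=1..n div 2. cos (2 * real l * y)) - (if even n then cos (real n * y) else 0)"
proof (cases "even n")
  case True
  then obtain p where p: "n = 2 * p" by blast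
  have "sin (2 * real p * y + y) = sin y * (1 + 2 * (\<Sum>l=1..p. cos (2 * real l * y)))"
    using dirichlet_kernel[of p y] by (simp add: algebra_simps)
  with assms p show ?thesis by (simp add: cst_def cot_def sin_add field_simps)
next
  case False
  then obtain p where p: "n = 2 * p + 1" by (elim oddE)
  have "real n = 2 * real p + 1" using p by simp
  then have "sin (real n * y) = sin y * (1 + 2 * (\<Sum>l=1..n div 2. cos (2 * real l * y)))"
    using dirichlet_kernel[of p y] p by (simp add: add.commute)
  then show ?thesis using assms False by (simp add: cst_def)
qed

text \<open>The half-angle at node \<open>k\<close>, multiplied by \<open>n\<close>, is
  \<open>n * \<theta> / 2 - k * pi\<close>, so the outer sine absorbs the sign
  \<open>(-1) ^ k\<close>. After expansion each cosine has a frequency index \<open>l\<close> with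
  \<open>0 < l < n\<close> and sums to zero over the nodes; the constants 1 add up to
  \<open>n\<close>.\<close>

lemma angular_denominator:
  assumes "n > 0" and nz: "\<And>k. k < n \<Longrightarrow> sin ((\<theta> - angular_node n k) / 2) \<noteq> 0"
  shows "sin (real n * \<theta> / 2) * (\<Sum>k<n. (-1) ^ k * cst n ((\<theta> - angular_node n k) / 2)) = real n"
proof -
  let ?y = "\<lambda>k. (\<theta> - angular_node n k) / 2"
  have arg: "2 * real l * ?y k = real l * \<theta> - 2 * pi * real l * real k / real n" for l k
    by (simp add: angular_node_def field_simps)
  have zero: "(\<Sum>k<n. cos (2 * real l * ?y k)) = 0" if "0 < l" "l < n" for l
    unfolding arg by (rule sum_cos_equally_spaced[OF that])
  have ny: "real n * ?y k = real n * \<theta> / 2 - real k * pi" for k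
    using assms(1) by (simp add: angular_node_def field_simps)
  have "sin (real n * \<theta> / 2) * (\<Sum>k<n. (-1) ^ k * cst n (?y k)) = (\<Sum>k<n. sin (real n * ?y k) * cst n (?y k))"
    unfolding ny by (simp add: sum_distrib_left sin_diff mult_ac)
  also have "\<dots> = (\<Sum>k<n. 1 + 2 * (\<Sum>l=1..n div 2. cos (2 * real l * ?y k)) -
      (if even n then cos (real n * ?y k) else 0))"
    by (intro sum.cong refl sin_mult_cst nz) auto
  also have "\<dots> = real n + 2 * (\<Sum>l=1..n div 2. \<Sum>k<n. cos (2 * real l * ?y k)) -
      (if even n then \<Sum>k<n. cos (real n * ?y k) else 0)"
    by (subst sum.swap) (cases "even n"; simp add: sum.distrib sum_subtractf flip: sum_distrib_left)
  also have "(\<Sum>l=1..n div 2. \<Sum>k<n. cos (2 * real l * ?y k)) = 0"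
    by (intro sum.neutral ballI zero) (use assms(1) in auto)
  also have "(if even n then \<Sum>k<n. cos (real n * ?y k) else 0) = 0"
  proof (cases "even n")
    case True
    then obtain p where "n = 2 * p" by blast
    with zero[of p] assms(1) show ?thesis by simp
  qed simp
  finally show ?thesis by simp
qed

section \<open>Bounds on sine and cosecant, reciprocal sums, and a reflection identity\<close>

lemma abs_sin_of_nat_mult_le: "\<bar>sin (real n * y)\<bar> \<le> real n * \<bar>sin y\<bar>"
proof (induction n)
  case (Suc n)
  have "sin (real (Suc n) * y) = sin (real n * y) * cos y + cos (real n * y) * sin y"
    by (simp add: distrib_right sin_add add.commute)
  also have "\<bar>\<dots>\<bar> \<le> \<bar>sin (real n * y)\<bar> * 1 + 1 * \<bar>sin y\<bar>"
    by (rule order_trans[OF abs_triangle_ineq], unfold abs_mult)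
      (intro add_mono mult_mono; simp)
  finally show ?case using Suc by (simp add: distrib_right)
qed simp

lemma abs_cst_le: "\<bar>cst n y\<bar> \<le> 1 / \<bar>sin y\<bar>"
  by (auto simp: cst_def cot_def divide_right_mono)

text \<open>Jordan's inequality: sine is concave on \<open>{0..pi}\<close> and so lies above its
  chord from 0 to \<open>pi / 2\<close>.\<close>

lemma two_mult_le_sin_pi_mult:
  assumes "0 \<le> x" "x \<le> 1 / 2"
  shows "2 * x \<le> sin (pi * x)"
proof -
  have "convex_on {0..pi} (\<lambda>x. - sin x)"
    by (rule f''_ge0_imp_convex[where f' = "\<lambda>x. - cos x" and f'' = sin])
      (auto intro!: derivative_eq_intros sin_ge_zero)
  from convex_onD[OF this, of "2 * x" 0 "pi / 2"] assms show ?thesis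
    by (simp add: mult.commute)
qed

text \<open>Both sides are invariant under \<open>x \<mapsto> 1 - x\<close>, which reduces the claim
  to Jordan's inequality on the first half. The two reciprocals stand for the two ways round the
  circle.\<close>

lemma inverse_sin_pi_mult_le:
  assumes "0 < x" "x < 1"
  shows "1 / sin (pi * x) \<le> (1 / x + 1 / (1 - x)) / 2"
proof -
  have half: "1 / sin (pi * z) \<le> (1 / z + 1 / (1 - z)) / 2" if "0 < z" "z \<le> 1 / 2" for z :: real
  proof -
    have "1 / sin (pi * z) \<le> 1 / (2 * z)"
      using two_mult_le_sin_pi_mult[of z] that by (intro divide_left_mono) auto
    also have "\<dots> = 1 / z / 2" by simp
    also have "\<dots> \<le> (1 / z + 1 / (1 - z)) / 2" using that by (intro divide_right_mono) auto
    finally show ?thesis .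
  qed
  show ?thesis
  proof (cases "x \<le> 1 / 2")
    case False
    with half[of "1 - x"] assms show ?thesis by (simp add: algebra_simps sin_diff)
  qed (use half assms in blast)
qed

text \<open>The distances to the two ends run through the same values in opposite order, so the
  averaged sum is \<open>harm (b - a - 1)\<close>.\<close>

lemma sum_reciprocal_distances_le:
  "(\<Sum>j\<in>{a<..<b}. (1 / real (j - a) + 1 / real (b - j)) / 2) \<le> (harm b :: real)"
proof -
  have e1: "(\<Sum>j\<in>{a<..<b}. 1 / real (j - a)) = harm (b - a - 1)"
    unfolding harm_def inverse_eq_divide
    by (rule sum.reindex_bij_witness[of _ "\<lambda>i. i + a" "\<lambda>j. j - a"]) auto
  have e2: "(\<Sum>j\<in>{a<..<b}. 1 / real (b - j)) = harm (b - a - 1)"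
    unfolding harm_def inverse_eq_divide
    by (rule sum.reindex_bij_witness[of _ "\<lambda>i. b - i" "\<lambda>j. b - j"]) auto
  have "harm (b - a - 1) \<le> (harm b :: real)" by (intro harm_mono) auto
  then show ?thesis by (simp only: e1 e2 sum.distrib sum_divide_distrib[symmetric] field_sum_of_halves add_divide_distrib)
qed

text \<open>Folds a sum over \<open>2 * n\<close> points of a circle onto a half circle by pairing
  \<open>k\<close> with \<open>2 * n - k\<close>. The ends 0 and \<open>n\<close> are their own
  partners, and the weight \<open>1 / 2\<close> keeps them from being counted twice.\<close>

lemma sum_end_weight_reflect:
  fixes h :: "nat \<Rightarrow> real"
  assumes n: "n > 0" and h: "h (2 * n) = h 0"
  shows "(\<Sum>k=0..n. end_weight n k * (h k + h (2 * n - k))) = (\<Sum>k<2 * n. h k)"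
proof -
  let ?f = "\<lambda>k. h k + h (2 * n - k)"
  have "(\<Sum>k=0..n. end_weight n k * ?f k) =
      (\<Sum>k=0..n. ?f k - (if k = 0 then ?f 0 / 2 else 0) - (if k = n then ?f n / 2 else 0))"
    using n by (intro sum.cong refl) (auto simp: end_weight_def field_simps)
  also have "\<dots> = (\<Sum>k=0..n. ?f k) - h 0 - h n"
    using n by (simp add: sum_subtractf h)
  also have "(\<Sum>k=0..n. ?f k) = (\<Sum>k=0..n. h k) + (\<Sum>k=n..2 * n. h k)"
  proof -
    have "(\<Sum>k=0..n. h (2 * n - k)) = (\<Sum>k=n..2 * n. h k)"
      by (rule sum.reindex_bij_witness[of _ "\<lambda>k. 2 * n - k" "\<lambda>k. 2 * n - k"]) auto
    then show ?thesis by (simp add: sum.distrib)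
  qed
  also have "(\<Sum>k=n..2 * n. h k) = (\<Sum>k=n..<2 * n. h k) + h 0"
    using h by (simp add: sum.last_plus)
  also have "(\<Sum>k=0..n. h k) = (\<Sum>k=0..<n. h k) + h n"
    by (simp add: sum.last_plus)
  finally have "(\<Sum>k=0..n. end_weight n k * ?f k) = (\<Sum>k=0..<n. h k) + (\<Sum>k=n..<2 * n. h k)"
    by simp
  also have "\<dots> = (\<Sum>k<2 * n. h k)"
    by (simp add: sum.atLeastLessThan_concat lessThan_atLeast0)
  finally show ?thesis .
qed

section \<open>Logarithmic bound for the angular factor\<close>

lemma angular_lagrange_le:
  assumes n: "n > 0" and \<theta>: "0 \<le> \<theta>" "\<theta> < 2 * pi"
    and nz: "\<And>k. k < n \<Longrightarrow> sin ((\<theta> - angular_node n k) / 2) \<noteq> 0"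
  shows "(\<Sum>j<n. \<bar>sin (real n * \<theta> / 2) * cst n ((\<theta> - angular_node n j) / 2) / real n\<bar>) \<le> 5 + 2 * ln (real n)"
proof -
  define T where "T j = \<bar>sin (real n * \<theta> / 2) * cst n ((\<theta> - angular_node n j) / 2) / real n\<bar>" for j
  \<comment> \<open>Position of \<open>\<theta>\<close> in units of the node spacing; it lies
    between the nodes \<open>m\<close> and \<open>m + 1\<close>.\<close>
  define u where "u = real n * \<theta> / (2 * pi)"
  define m where "m = nat \<lfloor>u\<rfloor>"
  have u: "0 \<le> u" "u < real n" using n \<theta> by (auto simp: u_def field_simps)
  have m: "real m \<le> u" "u < real m + 1" using u by (auto simp: m_def)
  have y: "(\<theta> - angular_node n j) / 2 = pi * ((u - real j) / real n)" for j
    using n by (simp add: angular_node_def u_def field_simps)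
  \<comment> \<open>Up to sign the numerator can be centred at any node, which allows the bound
    \<open>n * \<bar>sin y\<bar>\<close> near that node.\<close>
  have sin_eq: "\<bar>sin (real n * \<theta> / 2)\<bar> = \<bar>sin (real n * ((\<theta> - angular_node n j) / 2))\<bar>" for j
  proof -
    have "real n * ((\<theta> - angular_node n j) / 2) = real n * \<theta> / 2 - real j * pi"
      using n by (simp add: angular_node_def field_simps)
    then show ?thesis by (simp only: sin_diff) (simp add: abs_mult)
  qed
  have T_csc: "T j \<le> \<bar>sin (real n * \<theta> / 2)\<bar> / \<bar>sin ((\<theta> - angular_node n j) / 2)\<bar> / real n" for j
    using divide_right_mono[OF mult_left_mono[OF abs_cst_le[of n "(\<theta> - angular_node n j) / 2"],
          of "\<bar>sin (real n * \<theta> / 2)\<bar>"], of "real n"]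
    by (simp add: T_def abs_mult)
  have T_one: "T j \<le> 1" if "j < n" for j
    using T_csc[of j] abs_sin_of_nat_mult_le[of n "(\<theta> - angular_node n j) / 2"] nz[OF that] n
    unfolding sin_eq[of j] by (elim order_trans) (simp add: field_simps)
  \<comment> \<open>Away from \<open>\<theta>\<close> the numerator is bounded by 1;
    \<open>d\<close> and \<open>n - d\<close> are the two circular distances in units of the
    spacing.\<close>
  have T_dist: "T j \<le> (1 / d + 1 / (real n - d)) / 2"
    if "d = \<bar>u - real j\<bar>" "0 < d" "d < real n" for j d
  proof -
    have "u - real j = d \<or> u - real j = - d" using that(1) by linarith
    then have "\<bar>sin (pi * ((u - real j) / real n))\<bar> = \<bar>sin (pi * (d / real n))\<bar>"
      by (elim disjE) (simp_all only: minus_divide_left[symmetric] mult_minus_right sin_minus abs_minus_cancel)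
    also have "\<dots> = sin (pi * (d / real n))"
      using that(2,3) n by (intro abs_of_nonneg sin_ge_zero) (auto simp: field_simps)
    finally have s: "\<bar>sin ((\<theta> - angular_node n j) / 2)\<bar> = sin (pi * (d / real n))" by (simp add: y)
    have pos: "sin (pi * (d / real n)) > 0"
      using that(2,3) n by (intro sin_gt_zero) (auto simp: field_simps)
    have "T j \<le> 1 / sin (pi * (d / real n)) / real n"
      using pos by (intro order_trans[OF T_csc] divide_right_mono) (auto simp: s field_simps)
    also have "\<dots> \<le> ((1 / (d / real n) + 1 / (1 - d / real n)) / 2) / real n"
      using that(2,3) n by (intro divide_right_mono inverse_sin_pi_mult_le) auto
    also have "\<dots> = (1 / d + 1 / (real n - d)) / 2"
      using that(2,3) n by (simp add: divide_simps) (simp add: algebra_simps)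
    finally show ?thesis .
  qed
  let ?R = "\<lambda>a b j. (1 / real (j - a) + 1 / real (b - j)) / 2"
  \<comment> \<open>Replacing \<open>u\<close> by \<open>m\<close> shortens the direct distance, and
    \<open>u < n\<close> makes the distance the other way round at least \<open>j\<close>. Above
    \<open>\<theta>\<close> the roles are played by \<open>m + 1\<close> and by
    \<open>n - j\<close>.\<close>
  have below: "T j \<le> ?R 0 m j" if "j \<in> {0<..<m}" for j
  proof -
    have j: "real j \<ge> 1" "real m - real j \<ge> 1" using that by auto
    have "T j \<le> (1 / (u - real j) + 1 / (real n - (u - real j))) / 2"
      using T_dist[of "u - real j" j] j m u by simp
    also have "\<dots> \<le> (1 / (real m - real j) + 1 / real j) / 2"
      using j m u by (intro divide_right_mono add_mono divide_left_mono mult_pos_pos) auto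
    finally show ?thesis using that by (simp add: of_nat_diff add.commute)
  qed
  have above: "T j \<le> ?R (m + 1) n j" if "j \<in> {m + 1<..<n}" for j
  proof -
    have j: "real j - real (m + 1) \<ge> 1" "real n - real j \<ge> 1" using that by auto
    have "T j \<le> (1 / (real j - u) + 1 / (real n - (real j - u))) / 2"
      using T_dist[of "real j - u" j] j m u by simp
    also have "\<dots> \<le> (1 / (real j - real (m + 1)) + 1 / (real n - real j)) / 2"
      using j m u by (intro divide_right_mono add_mono divide_left_mono mult_pos_pos) auto
    finally show ?thesis using that by (simp add: of_nat_diff)
  qed
  have union: "(\<Sum>j\<in>A \<union> B. T j) \<le> (\<Sum>j\<in>A. T j) + (\<Sum>j\<in>B. T j)"
    if "finite A" "finite B" for A B
    using sum.union_inter[OF that, of T] sum_nonneg[of "A \<inter> B" T] by (simp add: T_def)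
  have T0: "0 \<le> T j" for j by (simp add: T_def)
  have mn: "m < n" using m u by linarith
  \<comment> \<open>The exceptional nodes: the neighbours \<open>m\<close> and \<open>m + 1\<close>
    of \<open>\<theta>\<close>, and 0, where the reciprocal of \<open>j\<close> would be
    \<open>1 / 0\<close>. Each contributes at most 1, whence the 3 below. The intersection covers
    the case \<open>m + 1 = n\<close>.\<close>
  let ?I = "{0, m, m + 1} \<inter> {..<n}"
  have "{..<n} \<subseteq> ?I \<union> ({0<..<m} \<union> {m + 1<..<n})" by auto
  then have "(\<Sum>j<n. T j) \<le> (\<Sum>j\<in>?I \<union> ({0<..<m} \<union> {m + 1<..<n}). T j)"
    by (intro sum_mono2) (auto simp: T0)
  also have "\<dots> \<le> (\<Sum>j\<in>?I. T j) + ((\<Sum>j\<in>{0<..<m}. T j) + (\<Sum>j\<in>{m + 1<..<n}. T j))"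
    by (intro order_trans[OF union] add_mono order_refl) auto
  also have "(\<Sum>j\<in>?I. T j) \<le> real (card ?I) * 1"
    by (intro sum_bounded_above) (auto simp: T_one)
  also have "real (card ?I) * 1 \<le> real (card {0, m, m + 1})"
    by (simp only: mult_1_right of_nat_le_iff) (intro card_mono; auto)
  also have "\<dots> \<le> 3" by (simp add: card_insert_if)
  also have "(\<Sum>j\<in>{0<..<m}. T j) \<le> harm m"
    by (rule order_trans[OF sum_mono[OF below] sum_reciprocal_distances_le])
  also have "harm m \<le> (harm n :: real)" using mn by (intro harm_mono) auto
  also have "(\<Sum>j\<in>{m + 1<..<n}. T j) \<le> harm n"
    by (rule order_trans[OF sum_mono[OF above] sum_reciprocal_distances_le])
  finally have "(\<Sum>j<n. T j) \<le> 3 + 2 * harm n" by simp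
  \<comment> \<open>The sequence \<open>harm n - ln n\<close> decreases from its value 1 at
    \<open>n = 1\<close>.\<close>
  moreover have "harm n \<le> 1 + ln (real n)"
    using euler_mascheroni_sequence_decreasing[of 1 n] n by (simp add: harm_def)
  ultimately show ?thesis unfolding T_def by simp
qed

text \<open>Stated for the quotients rather than the basis functions so that the radial estimate can
  apply it with \<open>2 * n\<close> nodes.\<close>

lemma sum_abs_angular_quotient_le:
  assumes n: "n > 0" and \<theta>: "0 \<le> \<theta>" "\<theta> < 2 * pi"
    and nz: "\<And>k. k < n \<Longrightarrow> sin ((\<theta> - angular_node n k) / 2) \<noteq> 0"
  shows "(\<Sum>j<n. \<bar>angular_quotient n j \<theta>\<bar>) \<le> 5 + 2 * ln (real n)"
proof -
  have s: "sin (real n * \<theta> / 2) \<noteq> 0"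
    using angular_denominator[OF n nz] n by auto
  have D: "(\<Sum>k<n. (-1) ^ k * cst n ((\<theta> - angular_node n k) / 2)) = real n / sin (real n * \<theta> / 2)"
    using angular_denominator[OF n nz] s by (simp add: field_simps)
  have "\<bar>angular_quotient n j \<theta>\<bar> = \<bar>sin (real n * \<theta> / 2) * cst n ((\<theta> - angular_node n j) / 2) / real n\<bar>" for j
    unfolding angular_quotient_def D by (simp add: abs_mult)
  then show ?thesis using angular_lagrange_le[OF assms] by simp
qed

lemma sum_abs_angular_basis_le:
  assumes n: "n > 0" and \<theta>: "0 \<le> \<theta>" "\<theta> < 2 * pi"
  shows "(\<Sum>j<n. \<bar>angular_basis n j \<theta>\<bar>) \<le> 5 + 2 * ln (real n)"
proof (cases "\<exists>k<n. \<theta> = angular_node n k")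
  case True
  then obtain k where k: "k < n" "\<theta> = angular_node n k" by blast
  have "(\<Sum>j<n. \<bar>angular_basis n j \<theta>\<bar>) = (\<Sum>j<n. if j = k then 1 else 0)"
    using k by (intro sum.cong) (auto simp: angular_basis_node)
  also have "\<dots> \<le> 5 + 2 * ln (real n)" using k by (simp add: sum.delta)
  finally show ?thesis .
next
  case False
  have node: "0 \<le> angular_node n k" "angular_node n k < 2 * pi" if "k < n" for k
    using that by (auto simp: angular_node_def field_simps)
  \<comment> \<open>The basis function also counts translates of nodes by \<open>2 * pi\<close> as
    nodes. Since \<open>\<theta>\<close> and the nodes lie in one period, a coincidence would force
    \<open>m = 0\<close>.\<close>
  have shift: "\<theta> \<noteq> angular_node n k + 2 * pi * of_int m" if "k < n" for k and m :: int
  proof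
    assume eq: "\<theta> = angular_node n k + 2 * pi * of_int m"
    have "2 * pi * of_int m < 2 * pi * 1" "2 * pi * (-1) < 2 * pi * of_int m"
      using eq node[OF that] \<theta> by linarith+
    then have "of_int m < (1 :: real)" "(-1 :: real) < of_int m"
      by (simp_all only: mult_less_cancel_left_pos pi_gt_zero zero_less_mult_iff zero_less_numeral simp_thms)
    then have "m = 0" by linarith
    with eq that False show False by auto
  qed
  have nz: "sin ((\<theta> - angular_node n k) / 2) \<noteq> 0" if k: "k < n" for k
  proof
    assume "sin ((\<theta> - angular_node n k) / 2) = 0"
    then obtain m :: int where "(\<theta> - angular_node n k) / 2 = of_int m * pi"
      by (auto simp: sin_zero_iff_int2)
    with shift[OF k, of m] show False by (simp add: field_simps)
  qed
  have "angular_basis n j \<theta> = angular_quotient n j \<theta>" for j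
    using shift by (auto simp: angular_basis_def)
  then show ?thesis using sum_abs_angular_quotient_le[OF n \<theta> nz] by simp
qed

section \<open>Reduction of the radial factor to the angular one\<close>

lemma cot_add_cot_half:
  fixes s t :: real
  assumes "sin ((t - s) / 2) \<noteq> 0" "sin ((t + s) / 2) \<noteq> 0"
  shows "cot ((t - s) / 2) + cot ((t + s) / 2) = 2 * sin t / (cos s - cos t)"
proof -
  have "cos s - cos t = 2 * (sin ((t + s) / 2) * sin ((t - s) / 2))"
    by (simp add: cos_diff_cos add.commute)
  moreover have "sin t = sin ((t - s) / 2 + (t + s) / 2)" by (simp add: field_simps)
  ultimately show ?thesis using assms
    by (simp only: sin_add cot_def) (simp add: field_simps)
qed

lemma sum_abs_radial_quotient_le:
  assumes n: "n > 0" and r: "0 \<le> r" "r \<le> 2" and nn: "\<And>k. k \<le> n \<Longrightarrow> r \<noteq> radial_node n k"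
  shows "(\<Sum>i=0..n. \<bar>radial_quotient n i r\<bar>) \<le> 5 + 2 * ln (real (2 * n))"
proof -
  define t where "t = arccos (1 - r)"
  have t: "0 \<le> t" "t \<le> pi" and rt: "r = 1 - cos t"
    using r by (auto simp: t_def arccos_lbound arccos_ubound)
  \<comment> \<open>The angles \<open>k * pi / n\<close> with \<open>k < 2 * n\<close> are the
    angular nodes for \<open>N\<close>; as \<open>N\<close> is even, \<open>cst N\<close> is the
    cotangent.\<close>
  define N where "N = 2 * n"
  define g where "g k = (-1) ^ k * cot ((t - angular_node N k) / 2)" for k
  have half: "angular_node N k = real k * pi / real n" for k
    by (simp add: angular_node_def N_def field_simps)
  have node_reflect: "angular_node N (2 * n - k) = 2 * pi - angular_node N k" if "k \<le> n" for k
    using that n by (simp add: half of_nat_diff field_simps)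
  have node: "radial_node n k = 1 - cos (angular_node N k)" for k
    by (simp add: radial_node_def half)
  \<comment> \<open>A zero would make \<open>cos t\<close> the cosine of node \<open>k\<close> or of
    its mirror image, hence \<open>r\<close> a radial node. The index \<open>2 * n\<close> is
    included as the mirror image of 0.\<close>
  have nz: "sin ((t - angular_node N k) / 2) \<noteq> 0" if "k \<le> 2 * n" for k
  proof
    assume "sin ((t - angular_node N k) / 2) = 0"
    then obtain m :: int where "(t - angular_node N k) / 2 = of_int m * pi"
      by (auto simp: sin_zero_iff_int2)
    then have "t = angular_node N k + of_int m * (2 * pi)" by (simp add: field_simps)
    then have c: "cos t = cos (angular_node N k)"
      by (simp only: cos_add cos_int_2pin sin_int_2pin mult.commute[of "of_int m"]
          mult_1_right mult_zero_right diff_zero)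
    show False
    proof (cases "k \<le> n")
      case True
      with nn[of k] show False by (simp add: rt node c)
    next
      case False
      then have k: "2 * n - k \<le> n" by linarith
      then have "cos t = cos (angular_node N (2 * n - k))"
        using node_reflect[of "2 * n - k"] that c by simp
      with nn[OF k] show False by (simp add: rt node)
    qed
  qed
  have g_refl: "g (2 * n - k) = (-1) ^ k * cot ((t + angular_node N k) / 2)"
    and nz': "sin ((t + angular_node N k) / 2) \<noteq> 0" if "k \<le> n" for k
  proof -
    \<comment> \<open>Reflecting the node shifts the half-angle by \<open>pi\<close>, a period of
      the cotangent.\<close>
    have e: "(t - angular_node N (2 * n - k)) / 2 = (t + angular_node N k) / 2 - pi"
      unfolding node_reflect[OF that] by (simp add: field_simps)
    have "(-1 :: real) ^ (2 * n - k) = (-1) ^ k"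
      using that by (simp add: uminus_power_if)
    then show "g (2 * n - k) = (-1) ^ k * cot ((t + angular_node N k) / 2)"
      unfolding g_def e by (simp add: cot_def sin_diff cos_diff)
    show "sin ((t + angular_node N k) / 2) \<noteq> 0"
      using nz[of "2 * n - k"] unfolding e by (simp add: sin_diff)
  qed
  \<comment> \<open>The factor \<open>2 * sin t\<close> is independent of \<open>k\<close> and
    cancels between numerator and denominator once \<open>sin t\<close> is known to be
    nonzero.\<close>
  have pair: "g k + g (2 * n - k) = 2 * sin t * ((-1) ^ k / (r - radial_node n k))" if "k \<le> n" for k
  proof -
    have "g k + g (2 * n - k) = (-1) ^ k * (cot ((t - angular_node N k) / 2) + cot ((t + angular_node N k) / 2))"
      using that by (simp add: g_refl distrib_left) (simp add: g_def)
    also have "\<dots> = (-1) ^ k * (2 * sin t / (r - radial_node n k))"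
      using that by (subst cot_add_cot_half) (auto simp: nz nz' rt node)
    finally show ?thesis by simp
  qed
  have end0: "g (2 * n) = g 0" using g_refl[of 0] by (simp add: g_def half)
  \<comment> \<open>Node 0 has angle 0 and node \<open>n\<close> has angle \<open>pi\<close>;
    avoiding them excludes the zeros of sine and of cosine at \<open>t / 2\<close>.\<close>
  have "sin (t / 2) \<noteq> 0" "cos (t / 2) \<noteq> 0"
    using nz[of 0] nz[of n] n by (auto simp: half sin_diff diff_divide_distrib)
  then have st: "sin t \<noteq> 0" using sin_double[of "t / 2"] by simp
  define D where "D = (\<Sum>k<2 * n. g k)"
  have D: "2 * sin t * (\<Sum>k=0..n. (-1) ^ k * end_weight n k / (r - radial_node n k)) = D"
    unfolding D_def sum_end_weight_reflect[OF n end0, symmetric] sum_distrib_left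
    by (intro sum.cong refl) (simp add: pair)
  have rq: "radial_quotient n i r = end_weight n i * (g i + g (2 * n - i)) / D" if "i \<le> n" for i
    unfolding radial_quotient_def D[symmetric] using st that by (simp add: pair)
  \<comment> \<open>The triangle inequality splits each pair, and the reflection identity for
    \<open>\<bar>g\<bar>\<close> unfolds the result into all \<open>2 * n\<close> angular quotients
    at \<open>t\<close>.\<close>
  have "(\<Sum>i=0..n. \<bar>radial_quotient n i r\<bar>) \<le> (\<Sum>i=0..n. end_weight n i * (\<bar>g i\<bar> + \<bar>g (2 * n - i)\<bar>) / \<bar>D\<bar>)"
    by (intro sum_mono)
      (auto simp: rq abs_mult end_weight_def intro!: divide_right_mono abs_triangle_ineq)
  also have "\<dots> = (\<Sum>k<2 * n. \<bar>g k\<bar>) / \<bar>D\<bar>"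
    unfolding sum_divide_distrib[symmetric] using sum_end_weight_reflect[OF n, of "\<lambda>k. \<bar>g k\<bar>"] end0 by simp
  also have "\<dots> = (\<Sum>j<N. \<bar>angular_quotient N j t\<bar>)"
    by (simp add: angular_quotient_def D_def g_def cst_def N_def sum_divide_distrib)
  also have "\<dots> \<le> 5 + 2 * ln (real N)"
    by (rule sum_abs_angular_quotient_le) (use n t nz in \<open>auto simp: N_def intro: le_less_trans[OF t(2)]\<close>)
  finally show ?thesis by (simp add: N_def)
qed

lemma sum_abs_radial_basis_le:
  assumes n: "n > 0" and r: "0 \<le> r" "r \<le> 2"
  shows "(\<Sum>i=0..n. \<bar>radial_basis n i r\<bar>) \<le> 5 + 2 * ln (real (2 * n))"
proof (cases "\<exists>k\<le>n. r = radial_node n k")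
  case True
  then obtain k where k: "k \<le> n" "r = radial_node n k" by blast
  have "(\<Sum>i=0..n. \<bar>radial_basis n i r\<bar>) = (\<Sum>i=0..n. if i = k then 1 else 0)"
    using k n by (intro sum.cong) (auto simp: radial_basis_node)
  also have "\<dots> \<le> 5 + 2 * ln (real (2 * n))" using k n by (simp add: sum.delta)
  finally show ?thesis .
next
  case False
  then have "radial_basis n i r = radial_quotient n i r" for i by (auto simp: radial_basis_def)
  then show ?thesis using sum_abs_radial_quotient_le[OF n r] False by auto
qed

section \<open>Product of the two factors and the asymptotic bound\<close>

lemma lebesgue_function_le:
  assumes pos: "\<And>\<phi>. 0 < \<rho> \<phi>" and n: "n1 \<ge> 3" "n2 \<ge> 3" and p: "p \<in> starlike_domain \<rho>"
  shows "lebesgue_function \<rho> n1 n2 p \<le> 63 * (ln (real n1) * ln (real n2))"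
proof -
  obtain \<xi> \<phi> where p': "p = (\<xi>, \<phi>)" "0 \<le> \<xi>" "\<xi> \<le> \<rho> \<phi>" "0 \<le> \<phi>" "\<phi> < 2 * pi"
    using p by (auto simp: starlike_domain_def)
  \<comment> \<open>From 3 on the logarithms absorb the additive constants:
    \<open>5 + 2 * ln 2 < 7\<close> gives the radial factor 9, \<open>5 + 2\<close> the angular
    factor 7, and their product is 63.\<close>
  have ln1: "1 \<le> ln (real k)" if "k \<ge> 3" for k
    using that ln3_gt_1 ln_mono[of 3 "real k"] by (simp add: order_trans[OF less_imp_le])
  have "(\<Sum>i=0..n1. \<bar>radial_basis n1 i (2 * \<xi> / \<rho> \<phi>)\<bar>) \<le> 5 + 2 * ln (real (2 * n1))"
    using n p' pos[of \<phi>] by (intro sum_abs_radial_basis_le) (auto simp: field_simps)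
  also have "\<dots> = 5 + 2 * ln 2 + 2 * ln (real n1)" using n by (simp add: ln_mult)
  also have "\<dots> \<le> 9 * ln (real n1)" using ln1[OF n(1)] ln_2_less_1 by simp
  finally have R: "(\<Sum>i=0..n1. \<bar>radial_basis n1 i (2 * \<xi> / \<rho> \<phi>)\<bar>) \<le> 9 * ln (real n1)" .
  have "(\<Sum>j<n2. \<bar>angular_basis n2 j \<phi>\<bar>) \<le> 5 + 2 * ln (real n2)"
    using n p' by (intro sum_abs_angular_basis_le) auto
  also have "\<dots> \<le> 7 * ln (real n2)" using ln1[OF n(2)] by simp
  finally have A: "(\<Sum>j<n2. \<bar>angular_basis n2 j \<phi>\<bar>) \<le> 7 * ln (real n2)" .
  have "lebesgue_function \<rho> n1 n2 p = (\<Sum>i=0..n1. \<bar>radial_basis n1 i (2 * \<xi> / \<rho> \<phi>)\<bar>) * (\<Sum>j<n2. \<bar>angular_basis n2 j \<phi>\<bar>)"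
    by (simp add: lebesgue_function_def p' star_map_def sum_product)
  also have "\<dots> \<le> (9 * ln (real n1)) * (7 * ln (real n2))"
    using R A n by (intro mult_mono) (auto intro!: sum_nonneg)
  finally show ?thesis by simp
qed

text \<open>The first conjunct makes the real suprema in the second genuine for all large indices.
  The product filter lets \<open>n1\<close> and \<open>n2\<close> grow independently.\<close>

theorem proposition1:
  fixes \<rho> :: "real \<Rightarrow> real"
  assumes pos: "\<And>\<phi>. 0 < \<rho> \<phi>"
    and periodic: "\<And>\<phi>. \<rho> (\<phi> + 2 * pi) = \<rho> \<phi>"
  shows "(\<forall>\<^sub>F (n1, n2) in sequentially \<times>\<^sub>F sequentially.
            bdd_above (lebesgue_function \<rho> n1 n2 ` starlike_domain \<rho>)) \<and>
         (\<lambda>(n1, n2). lebesgue_constant \<rho> n1 n2)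
           \<in> O[sequentially \<times>\<^sub>F sequentially](\<lambda>(n1, n2). ln (real n1) * ln (real n2))"
proof -
  have large: "\<forall>\<^sub>F (n1, n2) in sequentially \<times>\<^sub>F sequentially. n1 \<ge> 3 \<and> n2 \<ge> (3 :: nat)"
    by (subst case_prod_unfold, intro eventually_prodI eventually_ge_at_top)
  have bdd: "bdd_above (lebesgue_function \<rho> n1 n2 ` starlike_domain \<rho>)" if "n1 \<ge> 3" "n2 \<ge> 3" for n1 n2
    using lebesgue_function_le[OF pos that] by (intro bdd_aboveI2)
  \<comment> \<open>A point of the domain makes the supremum one over a nonempty set and, through
    the nonnegative value there, shows that the constant is nonnegative.\<close>
  have origin: "(0, 0) \<in> starlike_domain \<rho>"
    using pos[of 0] by (simp add: starlike_domain_def)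
  have const: "\<bar>lebesgue_constant \<rho> n1 n2\<bar> \<le> 63 * \<bar>ln (real n1) * ln (real n2)\<bar>" if n: "n1 \<ge> 3" "n2 \<ge> 3" for n1 n2
  proof -
    have "0 \<le> lebesgue_function \<rho> n1 n2 (0, 0)"
      by (auto simp: lebesgue_function_def intro!: sum_nonneg)
    also have "\<dots> \<le> lebesgue_constant \<rho> n1 n2"
      unfolding lebesgue_constant_def by (rule cSUP_upper[OF origin bdd[OF n]])
    finally have "0 \<le> lebesgue_constant \<rho> n1 n2" .
    moreover have "lebesgue_constant \<rho> n1 n2 \<le> 63 * (ln (real n1) * ln (real n2))"
      unfolding lebesgue_constant_def
      using origin lebesgue_function_le[OF pos n] by (intro cSUP_least) auto
    ultimately show ?thesis by simp
  qed
  show ?thesis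
  proof
    show "\<forall>\<^sub>F (n1, n2) in sequentially \<times>\<^sub>F sequentially.
        bdd_above (lebesgue_function \<rho> n1 n2 ` starlike_domain \<rho>)"
      using large by eventually_elim (auto intro: bdd)
    have "\<forall>\<^sub>F p in sequentially \<times>\<^sub>F sequentially.
        norm (case p of (n1, n2) \<Rightarrow> lebesgue_constant \<rho> n1 n2)
          \<le> 63 * norm (case p of (n1, n2) \<Rightarrow> ln (real n1) * ln (real n2))"
      using large by eventually_elim (use const in auto)
    then show "(\<lambda>(n1, n2). lebesgue_constant \<rho> n1 n2)
        \<in> O[sequentially \<times>\<^sub>F sequentially](\<lambda>(n1, n2). ln (real n1) * ln (real n2))"
      by (rule bigoI)
  qed
qed
end
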